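(* Let $\mathcal F$ be an equidistant foliation of $\mathbb R^{k+n}$ with affine leaf $F_0=\mathbb R^k\times\{0\}$. For any point $p\in F_0$ the induced foliation $\tilde{\mathcal F}_p=\{F\cap L_p\mid F\in\mathcal F\}$ of the horizontal layer $L_p$ is equidistant.
   Context: An equidistant foliation of $\mathbb R^m$ is a partition $\mathcal F$ of $\mathbb R^m$ into complete, smooth, connected, properly embedded submanifolds (leaves, possibly of different dimensions) such that for any two leaves $F,G\in\mathcal F$ and $p\in F$ the distance $\operatorname{dist}(p,G)$ does not depend on the choice of $p\in F$, and such that any vector tangent to a leaf can be locally extended to a smooth vector field everywhere tangent to the leaves. Every equidistant foliation of Euclidean space has a leaf that is an affine subspace; coordinates are chosen so that this leaf is $F_0=\mathbb R^k\times\{0\}$ ($k\ge0$). For $p\in F_0$ the horizontal layer is the affine space $L_p=p+\nu_pF_0=p+(\{0\}\times\mathbb R^n)$. Equidistance of $\tilde{\mathcal F}_p$ means that for any two leaves $A,B$ of $\tilde{\mathcal F}_p$ the distance $\operatorname{dist}(x,B)$ does not depend on $x\in A$. *)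

theory Defs
  imports "HOL-Analysis.Analysis"
begin

section \<open>Smooth maps and embedded submanifolds of Euclidean space\<close>

text \<open>Only used for open \<open>U\<close>. Class $C^{k+1}$ means differentiable with all directional
  derivatives of class $C^k$.\<close>

fun Ck_on :: "nat \<Rightarrow> ('a::euclidean_space \<Rightarrow> 'b::euclidean_space) \<Rightarrow> 'a set \<Rightarrow> bool" where
  "Ck_on 0 f U \<longleftrightarrow> continuous_on U f"
| "Ck_on (Suc k) f U \<longleftrightarrow>
     (\<forall>x\<in>U. f differentiable (at x)) \<and>
     (\<forall>v. Ck_on k (\<lambda>x. frechet_derivative f (at x) v) U)"

definition smooth_on :: "'a::euclidean_space set \<Rightarrow> ('a \<Rightarrow> 'b::euclidean_space) \<Rightarrow> bool" where
  "smooth_on U f \<longleftrightarrow> (\<forall>k. Ck_on k f U)"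

text \<open>Slice charts: near each of its points, \<open>S\<close> is straightened to a \<open>d\<close>-dimensional linear
  subspace by a diffeomorphism between open sets of the ambient space.\<close>

definition embedded_submanifold :: "nat \<Rightarrow> 'a::euclidean_space set \<Rightarrow> bool" where
  "embedded_submanifold d S \<longleftrightarrow>
     (\<forall>p\<in>S. \<exists>U V E (\<phi>::'a \<Rightarrow> 'a) \<psi>.
        open U \<and> p \<in> U \<and> open V \<and> homeomorphism U V \<phi> \<psi> \<and> smooth_on U \<phi> \<and> smooth_on V \<psi> \<and>
        subspace E \<and> dim E = d \<and> \<phi> ` (U \<inter> S) = V \<inter> E)"

definition properly_embedded :: "'a::euclidean_space set \<Rightarrow> bool" where
  "properly_embedded S \<longleftrightarrow> proper_map (top_of_set S) euclidean (\<lambda>x. x)"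

text \<open>Completeness of a leaf refers to the distance of the induced Riemannian metric, i.e. the
  infimum of the lengths of the curves inside \<open>S\<close>. Length is taken with \<open>has_integral\<close> so that
  curves whose speed is not integrable (which \<open>piecewise_C1_differentiable_on\<close> permits) are
  excluded rather than assigned the default integral \<open>0\<close>.\<close>

definition intrinsic_dist :: "'a::euclidean_space set \<Rightarrow> 'a \<Rightarrow> 'a \<Rightarrow> real" where
  "intrinsic_dist S x y =
     Inf {l. \<exists>\<gamma>::real \<Rightarrow> 'a. \<gamma> piecewise_C1_differentiable_on {0..1} \<and>
               \<gamma> ` {0..1} \<subseteq> S \<and> \<gamma> 0 = x \<and> \<gamma> 1 = y \<and>
               ((\<lambda>t. norm (vector_derivative \<gamma> (at t))) has_integral l) {0..1}}"

definition intrinsically_complete :: "'a::euclidean_space set \<Rightarrow> bool" where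
  "intrinsically_complete S \<longleftrightarrow> Metric_space.mcomplete S (intrinsic_dist S)"

definition tangent_space :: "'a::euclidean_space set \<Rightarrow> 'a \<Rightarrow> 'a set" where
  "tangent_space S p =
     {v. \<exists>\<epsilon>>0. \<exists>\<gamma>::real \<Rightarrow> 'a. smooth_on {-\<epsilon><..<\<epsilon>} \<gamma> \<and> \<gamma> ` {-\<epsilon><..<\<epsilon>} \<subseteq> S \<and>
            \<gamma> 0 = p \<and> (\<gamma> has_vector_derivative v) (at 0)}"

section \<open>Equidistant foliations\<close>

definition equidistant :: "'a::metric_space set set \<Rightarrow> bool" where
  "equidistant \<F> \<longleftrightarrow> (\<forall>A\<in>\<F>. \<forall>B\<in>\<F>. \<forall>x\<in>A. \<forall>y\<in>A. infdist x B = infdist y B)"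

definition equidistant_foliation :: "'a::euclidean_space set set \<Rightarrow> bool" where
  "equidistant_foliation \<F> \<longleftrightarrow>
     partition_on UNIV \<F> \<and>
     (\<forall>F\<in>\<F>. (\<exists>d. embedded_submanifold d F) \<and> connected F \<and>
            properly_embedded F \<and> intrinsically_complete F) \<and>
     equidistant \<F> \<and>
     (\<forall>F\<in>\<F>. \<forall>p\<in>F. \<forall>v\<in>tangent_space F p.
        \<exists>U (X::'a \<Rightarrow> 'a). open U \<and> p \<in> U \<and> smooth_on U X \<and> X p = v \<and>
          (\<forall>G\<in>\<F>. \<forall>q\<in>U \<inter> G. X q \<in> tangent_space G q))"

section \<open>The splitting of the coordinates and horizontal layers\<close>

text \<open>The splitting $\mathbb R^{k+n} = \mathbb R^k \times \mathbb R^n$ is given by the set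
  \<open>K\<close> of the first \<open>k\<close> coordinates, an arbitrary subset of the index type, so that \<open>k = card K\<close> and
  \<open>n = card (- K)\<close> may each be zero (a product of two Euclidean types would force both to be
  positive). Then $\mathbb R^k \times \{0\}$ is \<open>coord_subspace K\<close> and $\{0\} \times \mathbb R^n$ is
  \<open>coord_subspace (- K)\<close>.\<close>

definition coord_subspace :: "'m set \<Rightarrow> (real ^ 'm::finite) set" where
  "coord_subspace K = {x. \<forall>i. i \<notin> K \<longrightarrow> x $ i = 0}"

definition horizontal_layer :: "'m set \<Rightarrow> real ^ 'm \<Rightarrow> (real ^ 'm::finite) set" where
  "horizontal_layer K p = (\<lambda>v. p + v) ` coord_subspace (- K)"

text \<open>When \<open>coord_subspace K\<close> is a leaf through \<open>p\<close>, every leaf meets the layer (a nearest point of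
  the leaf to \<open>p\<close> lies in it), so none of these sets is empty and the convention
  \<open>infdist x {} = 0\<close> is irrelevant.\<close>

definition induced_foliation ::
    "(real ^ 'm) set set \<Rightarrow> 'm set \<Rightarrow> real ^ 'm \<Rightarrow> (real ^ 'm::finite) set set" where
  "induced_foliation \<F> K p = {F \<inter> horizontal_layer K p | F. F \<in> \<F>}"

end

theory Submission
  imports Defs
begin

text \<open>
  The argument is metric: the leaves partition the space, are closed, and have constant distances to each other.
  Write a point as \<open>x + y\<close> with \<open>x\<close> in the affine leaf $\mathbb R^k \times \{0\}$ and
  \<open>y\<close> orthogonal to it.

  The key fact is that the dilations \<open>x + y \<mapsto> x + \<mu> y\<close> with \<open>0 < \<mu> \<le>
  1\<close> map leaves onto leaves (\<open>dilation_of_leaf\<close>). Indeed, let \<open>r\<close> be the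
  distance of a leaf \<open>F\<close> to the affine leaf and let \<open>H\<close> be the leaf through the dilate
  of one point of \<open>F\<close>. Then \<open>H\<close> has distance \<open>\<mu> r\<close> to the affine leaf
  and distance at most \<open>(1 - \<mu>) r\<close> to \<open>F\<close>. These two distances add up to at most
  \<open>r\<close>, so the equality case of the triangle inequality forces a nearest point on \<open>H\<close>
  of any point of \<open>F\<close> to be its dilate, and likewise any point of \<open>H\<close> to be the dilate
  of its nearest point on \<open>F\<close>.

  Now let \<open>a\<close>, \<open>b\<close> be points of the same leaf and \<open>c\<close> a point of
  \<open>G\<close>, all in the layer over \<open>p\<close>. Dilation by \<open>\<mu>\<close> scales the distance
  of \<open>a\<close> and \<open>c\<close> by \<open>\<mu>\<close>. Since the dilates of \<open>a\<close> and
  \<open>b\<close> lie on one leaf and the dilate of \<open>G\<close> is a leaf, some \<open>z \<in> G\<close>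
  satisfies \<open>dist (dilate b) (dilate z) \<le> \<mu> dist a c\<close>. Orthogonally to the affine leaf this
  says that \<open>z\<close> is within \<open>dist a c\<close> of \<open>b\<close>; parallel to it, that
  \<open>z\<close> is within \<open>\<mu> dist a c\<close> of the layer (\<open>leaf_point_near_layer\<close>).
  As \<open>\<mu>\<close> tends to \<open>0\<close>, such points accumulate at a point of \<open>G\<close> in
  the layer at distance at most \<open>dist a c\<close> from \<open>b\<close>. In other words, blowing up the
  foliation at \<open>p\<close> produces the product of the affine leaf with the induced foliation, and
  equidistance passes to this limit.
\<close>

section \<open>The orthogonal splitting of the coordinates\<close>

definition coord_proj :: "'m set \<Rightarrow> real ^ 'm \<Rightarrow> real ^ 'm::finite" where
  "coord_proj K x = (\<chi> i. if i \<in> K then x $ i else 0)"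

definition dilation :: "'m set \<Rightarrow> real \<Rightarrow> real ^ 'm \<Rightarrow> real ^ 'm::finite" where
  "dilation K \<mu> x = coord_proj K x + \<mu> *\<^sub>R coord_proj (- K) x"

lemma linear_coord_proj: "linear (coord_proj K)"
  by (intro linearI) (auto simp: coord_proj_def vec_eq_iff)

lemmas coord_proj_diff = linear_diff[OF linear_coord_proj]
  and coord_proj_add = linear_add[OF linear_coord_proj]
  and coord_proj_scaleR = linear_scale[OF linear_coord_proj]

lemma coord_proj_idem [simp]: "coord_proj K (coord_proj K x) = coord_proj K x"
  by (simp add: coord_proj_def vec_eq_iff)

lemma coord_proj_compl [simp]:
  "coord_proj K (coord_proj (- K) x) = 0" "coord_proj (- K) (coord_proj K x) = 0"
  by (simp_all add: coord_proj_def vec_eq_iff)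

lemma coord_proj_decomp [simp]: "coord_proj K x + coord_proj (- K) x = x"
  by (simp add: coord_proj_def vec_eq_iff)

lemma norm_coord_proj_pythagoras:
  "(norm x)\<^sup>2 = (norm (coord_proj K x))\<^sup>2 + (norm (coord_proj (- K) x))\<^sup>2"
proof -
  have "(norm (coord_proj K x + coord_proj (- K) x))\<^sup>2 =
      (norm (coord_proj K x))\<^sup>2 + (norm (coord_proj (- K) x))\<^sup>2"
    by (rule norm_add_Pythagorean)
       (auto simp: orthogonal_def inner_vec_def coord_proj_def intro!: sum.neutral)
  then show ?thesis
    by simp
qed

lemma norm_coord_proj_le: "norm (coord_proj K x) \<le> norm x"
  using norm_coord_proj_pythagoras[of x K] by (simp add: abs_le_square_iff[symmetric] power2_le_imp_le)

lemma coord_proj_dilation [simp]: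
  "coord_proj K (dilation K \<mu> x) = coord_proj K x"
  "coord_proj (- K) (dilation K \<mu> x) = \<mu> *\<^sub>R coord_proj (- K) x"
  by (simp_all add: dilation_def coord_proj_add coord_proj_scaleR)

lemma coord_subspace_iff: "x \<in> coord_subspace K \<longleftrightarrow> coord_proj (- K) x = 0"
  by (auto simp: coord_subspace_def coord_proj_def vec_eq_iff)

lemma coord_subspace_iff_fixed: "x \<in> coord_subspace K \<longleftrightarrow> coord_proj K x = x"
  by (auto simp: coord_subspace_def coord_proj_def vec_eq_iff)

lemma infdist_coord_subspace:
  "infdist x (coord_subspace K) = norm (coord_proj (- K) x)"
proof (rule antisym)
  have "coord_proj K x \<in> coord_subspace K"
    by (simp add: coord_subspace_iff)
  moreover have "dist x (coord_proj K x) = norm (coord_proj (- K) x)"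
    by (metis add_diff_cancel_left' coord_proj_decomp dist_norm)
  ultimately show "infdist x (coord_subspace K) \<le> norm (coord_proj (- K) x)"
    by (metis infdist_le)
  have "norm (coord_proj (- K) x) \<le> dist x y" if "y \<in> coord_subspace K" for y
    using norm_coord_proj_le[of "- K" "x - y"] that
    by (simp add: dist_norm coord_proj_diff coord_subspace_iff)
  moreover have "coord_subspace K \<noteq> {}"
    using \<open>coord_proj K x \<in> coord_subspace K\<close> by blast
  ultimately show "norm (coord_proj (- K) x) \<le> infdist x (coord_subspace K)"
    by (auto simp: infdist_notempty intro!: cINF_greatest)
qed

lemma horizontal_layer_iff:
  assumes "p \<in> coord_subspace K"
  shows "x \<in> horizontal_layer K p \<longleftrightarrow> coord_proj K x = p"
proof
  assume "x \<in> horizontal_layer K p"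
  then show "coord_proj K x = p"
    using assms coord_subspace_iff[of _ "- K"] coord_subspace_iff_fixed[of p K]
    by (auto simp: horizontal_layer_def coord_proj_add)
next
  assume "coord_proj K x = p"
  then have "x = p + coord_proj (- K) x"
    by (metis coord_proj_decomp)
  then show "x \<in> horizontal_layer K p"
    unfolding horizontal_layer_def by (intro image_eqI) (auto simp: coord_subspace_iff)
qed

section \<open>Dilations map leaves onto leaves\<close>

text \<open>This is the equality case of the triangle inequality for the components orthogonal to the
  coordinate subspace: their distance is already at least \<open>(1 - \<mu>) r\<close>, so the parallel components
  must agree and the orthogonal ones must be aligned.\<close>

lemma eq_dilation_if_dist_le:
  assumes y: "norm (coord_proj (- K) y) = r" and z: "norm (coord_proj (- K) z) = \<mu> * r"
    and d: "dist y z \<le> (1 - \<mu>) * r"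
  shows "z = dilation K \<mu> y"
proof -
  define u v where "u = coord_proj (- K) z" and "v = coord_proj (- K) y - coord_proj (- K) z"
  have uv: "u + v = coord_proj (- K) y"
    by (simp add: u_def v_def)
  have pyth: "(dist y z)\<^sup>2 = (norm (coord_proj K y - coord_proj K z))\<^sup>2 + (norm v)\<^sup>2"
    using norm_coord_proj_pythagoras[of "y - z" K] by (simp add: dist_norm coord_proj_diff v_def)
  have v_le: "norm v \<le> dist y z"
    using norm_coord_proj_le[of "- K" "y - z"] by (simp add: dist_norm coord_proj_diff v_def)
  have v_ge: "norm v \<ge> (1 - \<mu>) * r"
    using norm_triangle_ineq[of u v] y z unfolding uv by (simp add: u_def algebra_simps)
  have nv: "norm v = (1 - \<mu>) * r" and "dist y z = norm v"
    using v_le v_ge d by auto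
  then have par: "coord_proj K y = coord_proj K z"
    using pyth by simp
  have "norm (u + v) = norm u + norm v"
    using y z nv unfolding uv by (simp add: u_def algebra_simps)
  then have "norm u *\<^sub>R v = norm v *\<^sub>R u"
    by (simp add: norm_triangle_eq)
  then have "(\<mu> * r) *\<^sub>R v = ((1 - \<mu>) * r) *\<^sub>R u"
    using z nv by (simp add: u_def)
  then have "r *\<^sub>R u = r *\<^sub>R (\<mu> *\<^sub>R (u + v))"
    by (simp add: algebra_simps)
  moreover have "u = 0 \<and> u + v = 0" if "r = 0"
    using that y z uv by (auto simp: u_def)
  ultimately have "u = \<mu> *\<^sub>R (u + v)"
    by (metis real_vector.scale_left_imp_eq scaleR_zero_right)
  then have orth: "coord_proj (- K) z = \<mu> *\<^sub>R coord_proj (- K) y"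
    unfolding uv unfolding u_def .
  show ?thesis
    using par orth by (metis coord_proj_decomp dilation_def)
qed

text \<open>The points \<open>x\<close> and \<open>dilation K \<mu> x\<close> are as close as the distances of \<open>F\<close> and \<open>H\<close> to the
  coordinate subspace permit.  By equidistance every point of either leaf has a partner on the other
  one that is equally close, and the rigidity above makes the partners dilates.\<close>

lemma dilation_of_leaf:
  fixes \<F> :: "(real ^ 'm::finite) set set"
  assumes eq: "equidistant \<F>" and closed: "\<And>A. A \<in> \<F> \<Longrightarrow> closed A"
    and K: "coord_subspace K \<in> \<F>"
    and F: "F \<in> \<F>" "x \<in> F" and H: "H \<in> \<F>" "dilation K \<mu> x \<in> H"
    and \<mu>: "0 < \<mu>" "\<mu> \<le> 1"
  shows "H = dilation K \<mu> ` F"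
proof -
  have infdist_const: "infdist y B = infdist z B"
    if "A \<in> \<F>" "B \<in> \<F>" "y \<in> A" "z \<in> A" for A B y z
    using eq that unfolding equidistant_def by blast
  define r where "r = norm (coord_proj (- K) x)"
  have rF: "norm (coord_proj (- K) y) = r" if "y \<in> F" for y
    using infdist_const[OF F(1) K F(2) that] by (simp add: infdist_coord_subspace r_def)
  have rH: "norm (coord_proj (- K) z) = \<mu> * r" if "z \<in> H" for z
    using infdist_const[OF H(1) K H(2) that] \<mu> by (simp add: infdist_coord_subspace r_def)
  have "x - dilation K \<mu> x = (1 - \<mu>) *\<^sub>R coord_proj (- K) x"
    by (subst coord_proj_decomp[of K x, symmetric])
       (simp add: dilation_def algebra_simps del: coord_proj_decomp)
  then have d: "dist x (dilation K \<mu> x) = (1 - \<mu>) * r"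
    using \<mu> by (simp add: dist_norm r_def)
  have "dilation K \<mu> y \<in> H" if y: "y \<in> F" for y
  proof -
    have "infdist y H \<le> (1 - \<mu>) * r"
      using infdist_const[OF F(1) H(1) F(2) y] infdist_le[OF H(2), of x] d by simp
    moreover obtain z where "z \<in> H" "infdist y H = dist y z"
      using infdist_attains_inf[OF closed[OF H(1)]] H(2) by blast
    ultimately show ?thesis
      using eq_dilation_if_dist_le[OF rF[OF y] rH] by metis
  qed
  moreover have "z \<in> dilation K \<mu> ` F" if z: "z \<in> H" for z
  proof -
    have "infdist z F \<le> (1 - \<mu>) * r"
      using infdist_const[OF H(1) F(1) H(2) z] infdist_le[OF F(2), of "dilation K \<mu> x"] d
      by (simp add: dist_commute)
    moreover obtain y where "y \<in> F" "infdist z F = dist z y"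
      using infdist_attains_inf[OF closed[OF F(1)]] F(2) by blast
    ultimately show ?thesis
      using eq_dilation_if_dist_le[OF rF rH[OF z]] by (metis dist_commute imageI)
  qed
  ultimately show ?thesis by blast
qed

section \<open>The blow-up at a point of the affine leaf\<close>

text \<open>Transporting a distance from \<open>a\<close> to \<open>b\<close> in the dilated foliation.  The parallel defect of
  the point obtained is controlled by \<open>\<mu>\<close>, because dilations do not shrink parallel components.\<close>

lemma leaf_point_near_layer:
  fixes \<F> :: "(real ^ 'm::finite) set set"
  assumes part: "partition_on UNIV \<F>" and eq: "equidistant \<F>"
    and closed: "\<And>A. A \<in> \<F> \<Longrightarrow> closed A" and K: "coord_subspace K \<in> \<F>"
    and leaves: "F \<in> \<F>" "G \<in> \<F>" "a \<in> F" "b \<in> F" "c \<in> G"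
    and ac: "coord_proj K a = coord_proj K c"
    and \<mu>: "0 < \<mu>" "\<mu> \<le> 1"
  obtains z where "z \<in> G" "norm (coord_proj K b - coord_proj K z) \<le> \<mu> * dist a c"
    "norm (coord_proj (- K) b - coord_proj (- K) z) \<le> dist a c"
proof -
  have leaf: "dilation K \<mu> ` A \<in> \<F>" if A: "A \<in> \<F>" "x \<in> A" for A x
  proof -
    obtain H where "H \<in> \<F>" "dilation K \<mu> x \<in> H"
      using part unfolding partition_on_def by blast
    then show ?thesis
      using dilation_of_leaf[OF eq closed K A _ _ \<mu>] by metis
  qed
  define G' where "G' = dilation K \<mu> ` G"
  have G': "G' \<in> \<F>" "dilation K \<mu> c \<in> G'"
    using leaf leaves by (auto simp: G'_def)
  have "dilation K \<mu> a - dilation K \<mu> c = \<mu> *\<^sub>R (a - c)"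
    using ac coord_proj_decomp[of K a] coord_proj_decomp[of K c]
    by (metis add_diff_cancel_left dilation_def scaleR_diff_right)
  then have "infdist (dilation K \<mu> a) G' \<le> \<mu> * dist a c"
    using infdist_le[OF G'(2), of "dilation K \<mu> a"] \<mu> by (simp add: dist_norm)
  moreover have "infdist (dilation K \<mu> a) G' = infdist (dilation K \<mu> b) G'"
    using eq leaf[OF leaves(1,3)] G'(1) imageI[OF leaves(3)] imageI[OF leaves(4)]
    unfolding equidistant_def by metis
  moreover obtain w where "w \<in> G'" "infdist (dilation K \<mu> b) G' = dist (dilation K \<mu> b) w"
    using infdist_attains_inf[OF closed[OF G'(1)]] G'(2) by blast
  ultimately obtain z where z: "z \<in> G"
      "norm (dilation K \<mu> b - dilation K \<mu> z) \<le> \<mu> * dist a c"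
    by (auto simp: G'_def dist_norm)
  show thesis
  proof
    show "z \<in> G" by fact
    show "norm (coord_proj K b - coord_proj K z) \<le> \<mu> * dist a c"
      using norm_coord_proj_le[of K "dilation K \<mu> b - dilation K \<mu> z"] z
      by (simp add: coord_proj_diff)
    have "norm (\<mu> *\<^sub>R (coord_proj (- K) b - coord_proj (- K) z)) \<le> \<mu> * dist a c"
      using norm_coord_proj_le[of "- K" "dilation K \<mu> b - dilation K \<mu> z"] z
      by (simp add: coord_proj_diff scaleR_diff_right)
    then show "norm (coord_proj (- K) b - coord_proj (- K) z) \<le> dist a c"
      using \<mu> by simp
  qed
qed

text \<open>The limit \<open>\<mu> \<rightarrow> 0\<close>, which exists because \<open>G\<close> is closed.\<close>

lemma leaf_point_in_layer:
  fixes \<F> :: "(real ^ 'm::finite) set set"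
  assumes part: "partition_on UNIV \<F>" and eq: "equidistant \<F>"
    and closed: "\<And>A. A \<in> \<F> \<Longrightarrow> closed A" and K: "coord_subspace K \<in> \<F>"
    and leaves: "F \<in> \<F>" "G \<in> \<F>" "a \<in> F" "b \<in> F" "c \<in> G"
    and ac: "coord_proj K a = coord_proj K c"
  obtains z where "z \<in> G" "coord_proj K z = coord_proj K b" "dist b z \<le> dist a c"
proof -
  define \<mu> where "\<mu> n = 1 / real (Suc n)" for n
  have \<mu>: "0 < \<mu> n" "\<mu> n \<le> 1" for n
    by (auto simp: \<mu>_def)
  have "\<exists>z\<in>G. norm (coord_proj K b - coord_proj K z) \<le> \<mu> n * dist a c \<and>
      norm (coord_proj (- K) b - coord_proj (- K) z) \<le> dist a c" for n
    using leaf_point_near_layer[OF part eq closed K leaves ac \<mu>(1)[of n] \<mu>(2)[of n]] by metis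
  then obtain z where z: "\<And>n. z n \<in> G"
      "\<And>n. norm (coord_proj K b - coord_proj K (z n)) \<le> \<mu> n * dist a c"
      "\<And>n. norm (coord_proj (- K) b - coord_proj (- K) (z n)) \<le> dist a c"
    by metis
  have "dist b (z n) \<le> 2 * dist a c" for n
  proof -
    have "dist b (z n) \<le> norm (coord_proj K (b - z n)) + norm (coord_proj (- K) (b - z n))"
      using norm_triangle_ineq[of "coord_proj K (b - z n)" "coord_proj (- K) (b - z n)"]
      by (simp add: dist_norm)
    also have "\<dots> \<le> \<mu> n * dist a c + dist a c"
      using z(2,3)[of n] by (simp add: coord_proj_diff)
    also have "\<dots> \<le> 2 * dist a c"
      using \<mu>[of n] mult_right_mono[of "\<mu> n" 1 "dist a c"] by simp
    finally show ?thesis .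
  qed
  then have "\<forall>n. z n \<in> cball b (2 * dist a c)"
    by simp
  then obtain l s where s: "strict_mono (s :: nat \<Rightarrow> nat)" "(z \<circ> s) \<longlonglongrightarrow> l"
    using compact_cball[of b "2 * dist a c"] unfolding compact_def by metis
  have "l \<in> G"
    using closed_sequentially[OF closed[OF leaves(2)] _ s(2)] z(1) by simp
  have lim: "(\<lambda>n. coord_proj J b - coord_proj J ((z \<circ> s) n)) \<longlonglongrightarrow> coord_proj J b - coord_proj J l"
    for J
    by (intro tendsto_intros bounded_linear.tendsto[OF _ s(2)])
       (simp add: linear_conv_bounded_linear[symmetric] linear_coord_proj)
  have "\<mu> \<longlonglongrightarrow> 0"
    unfolding \<mu>_def using LIMSEQ_inverse_real_of_nat by (simp add: inverse_eq_divide)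
  then have "(\<lambda>n. \<mu> (s n) * dist a c) \<longlonglongrightarrow> 0 * dist a c"
    using LIMSEQ_subseq_LIMSEQ[OF _ s(1)] by (intro tendsto_intros) (auto simp: o_def)
  then have "norm (coord_proj K b - coord_proj K l) \<le> 0 * dist a c"
    using z(2) by (intro LIMSEQ_le[OF tendsto_norm[OF lim]]) auto
  then have par: "coord_proj K l = coord_proj K b"
    by simp
  moreover have "norm (coord_proj (- K) b - coord_proj (- K) l) \<le> dist a c"
    using z(3) by (intro LIMSEQ_le_const2[OF tendsto_norm[OF lim]]) auto
  then have "dist b l \<le> dist a c"
    using par coord_proj_decomp[of K b] coord_proj_decomp[of K l]
    by (metis add_diff_cancel_left dist_norm)
  ultimately show thesis
    using that \<open>l \<in> G\<close> by blast
qed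

lemma closed_if_properly_embedded:
  assumes "properly_embedded S"
  shows "closed S"
proof -
  have "closed_map (top_of_set S) euclidean (\<lambda>x. x)"
    using assms unfolding properly_embedded_def by (rule proper_imp_closed_map)
  then show ?thesis
    by (auto simp: closed_map_def dest: spec[of _ S])
qed

theorem proposition3p13:
  fixes \<F> :: "(real ^ 'm::finite) set set"
    and K :: "'m set"
    and p :: "real ^ 'm"
  assumes "equidistant_foliation \<F>"
    and "coord_subspace K \<in> \<F>"
    and "p \<in> coord_subspace K"
  shows "equidistant (induced_foliation \<F> K p)"
proof -
  have part: "partition_on UNIV \<F>" and eq: "equidistant \<F>"
    and closed: "\<And>A. A \<in> \<F> \<Longrightarrow> closed A"
    using assms(1) unfolding equidistant_foliation_def
    by (auto intro: closed_if_properly_embedded)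
  have le: "infdist b (G \<inter> horizontal_layer K p) \<le> infdist a (G \<inter> horizontal_layer K p)"
    if "F \<in> \<F>" "G \<in> \<F>" "a \<in> F" "b \<in> F" "a \<in> horizontal_layer K p" "b \<in> horizontal_layer K p"
    for F G a b
  proof (cases "G \<inter> horizontal_layer K p = {}")
    case False
    have "infdist b (G \<inter> horizontal_layer K p) \<le> dist a c"
      if c: "c \<in> G \<inter> horizontal_layer K p" for c
    proof -
      have "coord_proj K a = coord_proj K c" "c \<in> G"
        using c \<open>a \<in> horizontal_layer K p\<close> by (auto simp: horizontal_layer_iff[OF assms(3)])
      then obtain z where "z \<in> G" "coord_proj K z = coord_proj K b" "dist b z \<le> dist a c"
        using leaf_point_in_layer[OF part eq closed assms(2) \<open>F \<in> \<F>\<close> \<open>G \<in> \<F>\<close> \<open>a \<in> F\<close> \<open>b \<in> F\<close>]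
        by metis
      then show ?thesis
        using \<open>b \<in> horizontal_layer K p\<close>
        by (intro infdist_le2[of z]) (auto simp: horizontal_layer_iff[OF assms(3)])
    qed
    then show ?thesis
      using False by (auto simp: infdist_notempty intro!: cINF_greatest)
  next
    case True
    \<comment> \<open>Both distances are \<open>0\<close> by the convention \<open>infdist x {} = 0\<close>.\<close>
    then show ?thesis
      by (simp add: infdist_def)
  qed
  show ?thesis
    unfolding equidistant_def induced_foliation_def by (auto intro!: antisym le)
qed

end
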